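(* Let $n$ be a positive integer and let $\mathcal{X}$ be a reflexive linear subspace of $L^1(\mathbf{R}^n)$ of infinite dimension. Then for each choice of positive numbers $\beta$ and $C$ there is an $f\in\mathcal{X}$ such that $$\sum_{Q\in\mathcal{Q}}\left|\int_{\beta Q}f(x)\,dx\right|\;<\;C\,\|f\|_{L^1(\mathbf{R}^n)}.$$
   Context: Functions are complex-valued and $\mathbf{R}^n$ carries Lebesgue measure; $\mathcal{X}$ carries the $L^1$ norm. $\mathcal{Q}$ is the countable collection of all cubes $Q=\{x\in\mathbf{R}^n: c_k\le x_k\le c_k+1,\ k\in\{1,\dots,n\}\}$, where $c_1,\dots,c_n$ are integers. For $\beta>0$ and such a $Q$, $\beta Q=\{x\in\mathbf{R}^n:\beta c_k\le x_k\le\beta(c_k+1),\ k\in\{1,\dots,n\}\}$. *)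

theory Defs
  imports "HOL-Analysis.Analysis" "HOL-Library.Function_Algebras"
begin

section \<open>The complex Banach space $L^1$ of Lebesgue measure\<close>

definition L1_rel :: "('a::euclidean_space \<Rightarrow> complex) \<Rightarrow> ('a \<Rightarrow> complex) \<Rightarrow> bool"
  where "L1_rel f g \<longleftrightarrow> integrable lebesgue f \<and> integrable lebesgue g \<and> (AE x in lebesgue. f x = g x)"

quotient_type (overloaded) 'a L1 = "'a::euclidean_space \<Rightarrow> complex" / partial: L1_rel
proof (rule part_equivpI)
  show "\<exists>f :: 'a \<Rightarrow> complex. L1_rel f f"
    by (rule exI[of _ "\<lambda>_. 0"]) (simp add: L1_rel_def)
  show "symp (L1_rel :: ('a \<Rightarrow> complex) \<Rightarrow> _)"
    by (rule sympI) (auto simp: L1_rel_def elim: AE_mp)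
  show "transp (L1_rel :: ('a \<Rightarrow> complex) \<Rightarrow> _)"
    by (rule transpI) (auto simp: L1_rel_def elim: AE_mp)
qed

instantiation L1 :: (euclidean_space) real_normed_vector
begin

lift_definition zero_L1 :: "'a L1" is "\<lambda>_. 0"
  by (simp add: L1_rel_def)

lift_definition plus_L1 :: "'a L1 \<Rightarrow> 'a L1 \<Rightarrow> 'a L1" is "\<lambda>f g x. f x + g x"
  by (auto simp: L1_rel_def elim: AE_mp)

lift_definition uminus_L1 :: "'a L1 \<Rightarrow> 'a L1" is "\<lambda>f x. - f x"
  by (auto simp: L1_rel_def elim: AE_mp)

lift_definition minus_L1 :: "'a L1 \<Rightarrow> 'a L1 \<Rightarrow> 'a L1" is "\<lambda>f g x. f x - g x"
  by (auto simp: L1_rel_def elim: AE_mp)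

lift_definition scaleR_L1 :: "real \<Rightarrow> 'a L1 \<Rightarrow> 'a L1" is "\<lambda>r f x. r *\<^sub>R f x"
  by (auto simp: L1_rel_def elim: AE_mp)

lift_definition norm_L1 :: "'a L1 \<Rightarrow> real" is "\<lambda>f. \<integral>x. norm (f x) \<partial>lebesgue"
  by (rule integral_cong_AE) (auto simp: L1_rel_def elim: AE_mp)

definition dist_L1 :: "'a L1 \<Rightarrow> 'a L1 \<Rightarrow> real"
  where "dist_L1 f g = norm (f - g)"

definition sgn_L1 :: "'a L1 \<Rightarrow> 'a L1"
  where "sgn_L1 f = inverse (norm f) *\<^sub>R f"

definition uniformity_L1 :: "('a L1 \<times> 'a L1) filter"
  where "uniformity_L1 = (INF e\<in>{0 <..}. principal {(f, g). dist f g < e})"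

definition open_L1 :: "'a L1 set \<Rightarrow> bool"
  where "open_L1 U \<longleftrightarrow> (\<forall>f\<in>U. eventually (\<lambda>(f', g). f' = f \<longrightarrow> g \<in> U) uniformity)"

instance
proof
  fix f g h :: "'a L1" and a b :: real
  show "f + g + h = f + (g + h)"
    by transfer (auto simp: L1_rel_def add.assoc)
  show "f + g = g + f"
    by transfer (auto simp: L1_rel_def add.commute)
  show "0 + f = f"
    by transfer (auto simp: L1_rel_def)
  show "- f + f = 0"
    by transfer (auto simp: L1_rel_def)
  show "f - g = f + - g"
    by transfer (auto simp: L1_rel_def)
  show "a *\<^sub>R (f + g) = a *\<^sub>R f + a *\<^sub>R g"
    by transfer (auto simp: L1_rel_def scaleR_add_right)
  show "(a + b) *\<^sub>R f = a *\<^sub>R f + b *\<^sub>R f"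
    by transfer (auto simp: L1_rel_def scaleR_add_left)
  show "a *\<^sub>R b *\<^sub>R f = (a * b) *\<^sub>R f"
    by transfer (auto simp: L1_rel_def)
  show "1 *\<^sub>R f = f"
    by transfer (auto simp: L1_rel_def)
  show "dist f g = norm (f - g)"
    by (fact dist_L1_def)
  show "sgn f = inverse (norm f) *\<^sub>R f"
    by (fact sgn_L1_def)
  show "uniformity = (INF e\<in>{0 <..}. principal {(f :: 'a L1, g). dist f g < e})"
    by (fact uniformity_L1_def)
  show "open U \<longleftrightarrow> (\<forall>f\<in>U. eventually (\<lambda>(f', g). f' = f \<longrightarrow> g \<in> U) uniformity)" for U :: "'a L1 set"
    by (fact open_L1_def)
  show "norm f = 0 \<longleftrightarrow> f = 0"
    by transfer (auto simp: L1_rel_def integral_nonneg_eq_0_iff_AE)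
  show "norm (f + g) \<le> norm f + norm g"
  proof transfer
    fix f g :: "'a \<Rightarrow> complex"
    assume "L1_rel f f" "L1_rel g g"
    then have f: "integrable lebesgue f" and g: "integrable lebesgue g"
      by (auto simp: L1_rel_def)
    then have "(\<integral>x. norm (f x + g x) \<partial>lebesgue) \<le> (\<integral>x. norm (f x) + norm (g x) \<partial>lebesgue)"
      by (intro integral_mono) (auto intro: norm_triangle_ineq)
    with f g show "(\<integral>x. norm (f x + g x) \<partial>lebesgue)
        \<le> (\<integral>x. norm (f x) \<partial>lebesgue) + (\<integral>x. norm (g x) \<partial>lebesgue)"
      by simp
  qed
  show "norm (a *\<^sub>R f) = \<bar>a\<bar> * norm f"
    by transfer simp
qed

end

lift_definition scale_L1 :: "complex \<Rightarrow> 'a::euclidean_space L1 \<Rightarrow> 'a L1" is "\<lambda>c f x. c * f x"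
  by (auto simp: L1_rel_def elim: AE_mp)

global_interpretation L1: vector_space "scale_L1 :: complex \<Rightarrow> 'a::euclidean_space L1 \<Rightarrow> 'a L1"
proof
  fix c d :: complex and f g :: "'a L1"
  show "scale_L1 c (f + g) = scale_L1 c f + scale_L1 c g"
    by transfer (auto simp: L1_rel_def distrib_left)
  show "scale_L1 (c + d) f = scale_L1 c f + scale_L1 d f"
    by transfer (auto simp: L1_rel_def distrib_right)
  show "scale_L1 c (scale_L1 d f) = scale_L1 (c * d) f"
    by transfer (auto simp: L1_rel_def mult.assoc)
  show "scale_L1 1 f = f"
    by transfer (auto simp: L1_rel_def)
qed

lemma borel_measurable_lebesgue_AE_cong:
  fixes f g :: "'a::euclidean_space \<Rightarrow> complex"
  assumes f: "f \<in> borel_measurable lebesgue" and eq: "AE x in lebesgue. f x = g x"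
  shows "g \<in> borel_measurable lebesgue"
proof (rule measurableI)
  fix A :: "complex set"
  assume "A \<in> sets borel"
  have "AE x in lebesgue. (x \<in> f -` A \<inter> space lebesgue) = (x \<in> g -` A \<inter> space lebesgue)"
    using eq by eventually_elim auto
  moreover from f \<open>A \<in> sets borel\<close> have "f -` A \<inter> space lebesgue \<in> sets lebesgue"
    by (rule measurable_sets)
  ultimately show "g -` A \<inter> space lebesgue \<in> sets lebesgue"
    by (rule completion.in_sets_AE) auto
qed auto

lift_definition integral_L1 :: "'a::euclidean_space set \<Rightarrow> 'a L1 \<Rightarrow> complex"
  is "\<lambda>S f. set_lebesgue_integral lebesgue S f"
proof -
  fix S :: "'a set" and f g :: "'a \<Rightarrow> complex"
  assume "L1_rel f g"
  then have AE: "AE x in lebesgue. indicator S x *\<^sub>R f x = indicator S x *\<^sub>R g x"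
    unfolding L1_rel_def by (auto elim: eventually_mono)
  then have AE': "AE x in lebesgue. indicator S x *\<^sub>R g x = indicator S x *\<^sub>R f x"
    by eventually_elim (rule sym)
  show "set_lebesgue_integral lebesgue S f = set_lebesgue_integral lebesgue S g"
  proof (cases "(\<lambda>x. indicator S x *\<^sub>R f x) \<in> borel_measurable lebesgue")
    case True
    with AE show ?thesis
      unfolding set_lebesgue_integral_def
      by (intro integral_cong_AE borel_measurable_lebesgue_AE_cong[OF True AE])
  next
    case False
    moreover from this have "(\<lambda>x. indicator S x *\<^sub>R g x) \<notin> borel_measurable lebesgue"
      using borel_measurable_lebesgue_AE_cong[OF _ AE'] by blast
    ultimately show ?thesis
      unfolding set_lebesgue_integral_def
      by (metis borel_measurable_integrable not_integrable_integral_eq)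
  qed
qed

section \<open>Reflexivity\<close>

text \<open>
  A complex normed space is given by a carrier set \<open>X\<close>, a scalar multiplication \<open>scl\<close> and a
  norm \<open>nrm\<close>, so that subspaces and (iterated) duals can be treated uniformly. Functionals are
  taken to vanish off \<open>X\<close>, so that they are equal as HOL functions iff they agree on \<open>X\<close>;
  addition of functionals is the pointwise one of \<^theory>\<open>HOL-Library.Function_Algebras\<close>.
\<close>

definition dual_space ::
  "(complex \<Rightarrow> 'v \<Rightarrow> 'v) \<Rightarrow> ('v \<Rightarrow> real) \<Rightarrow> 'v::ab_group_add set \<Rightarrow> ('v \<Rightarrow> complex) set"
  where "dual_space scl nrm X =
    {\<phi>. (\<forall>x. x \<notin> X \<longrightarrow> \<phi> x = 0) \<and>
        (\<forall>x\<in>X. \<forall>y\<in>X. \<phi> (x + y) = \<phi> x + \<phi> y) \<and>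
        (\<forall>c. \<forall>x\<in>X. \<phi> (scl c x) = c * \<phi> x) \<and>
        (\<exists>K. \<forall>x\<in>X. cmod (\<phi> x) \<le> K * nrm x)}"

definition dual_norm :: "('v \<Rightarrow> real) \<Rightarrow> 'v set \<Rightarrow> ('v \<Rightarrow> complex) \<Rightarrow> real"
  where "dual_norm nrm X \<phi> = (SUP x\<in>{x \<in> X. nrm x \<le> 1}. cmod (\<phi> x))"

definition bidual_space ::
  "(complex \<Rightarrow> 'v \<Rightarrow> 'v) \<Rightarrow> ('v \<Rightarrow> real) \<Rightarrow> 'v::ab_group_add set \<Rightarrow> (('v \<Rightarrow> complex) \<Rightarrow> complex) set"
  where "bidual_space scl nrm X =
    dual_space (\<lambda>c \<phi> x. c * \<phi> x) (dual_norm nrm X) (dual_space scl nrm X)"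

definition canonical_embedding ::
  "(complex \<Rightarrow> 'v \<Rightarrow> 'v) \<Rightarrow> ('v \<Rightarrow> real) \<Rightarrow> 'v::ab_group_add set \<Rightarrow> 'v \<Rightarrow> ('v \<Rightarrow> complex) \<Rightarrow> complex"
  where "canonical_embedding scl nrm X x = (\<lambda>\<phi>. if \<phi> \<in> dual_space scl nrm X then \<phi> x else 0)"

definition reflexive_space ::
  "(complex \<Rightarrow> 'v \<Rightarrow> 'v) \<Rightarrow> ('v \<Rightarrow> real) \<Rightarrow> 'v::ab_group_add set \<Rightarrow> bool"
  where "reflexive_space scl nrm X \<longleftrightarrow>
    canonical_embedding scl nrm X ` X = bidual_space scl nrm X"

section \<open>Cubes\<close>

definition unit_cube :: "int ^ 'n \<Rightarrow> (real ^ 'n) set"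
  where "unit_cube c = {x. \<forall>k. of_int (c $ k) \<le> x $ k \<and> x $ k \<le> of_int (c $ k) + 1}"

definition integer_cubes :: "(real ^ 'n) set set"
  where "integer_cubes = range unit_cube"

definition dilate :: "real \<Rightarrow> (real ^ 'n) set \<Rightarrow> (real ^ 'n) set"
  where "dilate \<beta> Q = (\<lambda>x. \<beta> *\<^sub>R x) ` Q"

lemma dilate_unit_cube:
  fixes c :: "int ^ 'n"
  assumes "\<beta> > 0"
  shows "dilate \<beta> (unit_cube c) =
    {x. \<forall>k. \<beta> * of_int (c $ k) \<le> x $ k \<and> x $ k \<le> \<beta> * (of_int (c $ k) + 1)}"
proof (rule set_eqI)
  fix x :: "real ^ 'n"
  have "x \<in> dilate \<beta> (unit_cube c) \<longleftrightarrow> inverse \<beta> *\<^sub>R x \<in> unit_cube c"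
    using assms unfolding dilate_def by (auto intro!: image_eqI[of _ _ "inverse \<beta> *\<^sub>R x"])
  also have "\<dots> \<longleftrightarrow> (\<forall>k. \<beta> * of_int (c $ k) \<le> x $ k \<and> x $ k \<le> \<beta> * (of_int (c $ k) + 1))"
    using assms by (simp add: unit_cube_def field_simps)
  finally show "x \<in> dilate \<beta> (unit_cube c) \<longleftrightarrow>
      x \<in> {x. \<forall>k. \<beta> * of_int (c $ k) \<le> x $ k \<and> x $ k \<le> \<beta> * (of_int (c $ k) + 1)}"
    by simp
qed

end

theory Submission
  imports Defs
begin

text \<open>
  The map \<open>f \<mapsto> (\<integral> f over \<beta>Q)\<close>, indexed by the cubes \<open>Q\<close>, is a contraction from \<open>L\<^sup>1\<close> to \<open>\<ell>\<^sup>1\<close>,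
  since the cubes overlap in null sets only (\<open>sum_cube_integrals_le_norm\<close>). The claim is that it
  is not bounded below on \<open>X\<close>, and this holds for every bounded operator from an
  infinite-dimensional reflexive space to \<open>\<ell>\<^sup>1\<close> (\<open>reflexive_to_l1_not_bounded_below\<close>): an
  infinite-dimensional subspace of \<open>\<ell>\<^sup>1\<close> contains a copy of \<open>\<ell>\<^sup>1\<close>, which is not reflexive.

  The direct argument is a gliding hump. Suppose that the operator is bounded below by \<open>C\<close>.
  Finitely many linear conditions never exhaust an infinite-dimensional space
  (\<open>common_kernel_nontrivial\<close>), so there are unit vectors \<open>f\<^sub>k\<close> and finite sets
  \<open>F\<^sub>0 \<subseteq> F\<^sub>1 \<subseteq> \<dots>\<close> of coordinates such that the coordinates of \<open>f\<^sub>k\<close> vanish on \<open>F\<^sub>k\<close> and their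
  absolute sum off \<open>F\<^sub>k\<^sub>+\<^sub>1\<close> is at most \<open>C / 4\<close>. By reflexivity the \<open>f\<^sub>k\<close> have a weak cluster
  point \<open>x\<close> in \<open>X\<close> (\<open>reflexive_imp_weak_cluster_point\<close>). Each coordinate in some \<open>F\<^sub>m\<close> is
  eventually zero along the sequence, hence zero at \<open>x\<close>. Multiplying these coordinates by
  suitable constants of modulus at most one and adding them up gives a bounded functional that is at least
  \<open>C / 2\<close> in modulus at every \<open>f\<^sub>k\<close>, hence also at \<open>x\<close>. But it only reads coordinates
  that vanish at \<open>x\<close>.
\<close>

section \<open>Subspaces of finite codimension\<close>

context vector_space
begin

lemma subspace_inter_kernel:
  assumes Y: "subspace Y"
    and add: "\<And>x y. x \<in> Y \<Longrightarrow> y \<in> Y \<Longrightarrow> \<phi> (x + y) = \<phi> x + \<phi> y"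
    and scl: "\<And>c x. x \<in> Y \<Longrightarrow> \<phi> (scale c x) = c * \<phi> x"
  shows "subspace {y \<in> Y. \<phi> y = 0}"
proof (rule subspaceI)
  have "\<phi> (scale 0 0) = 0 * \<phi> 0"
    using scl subspace_0[OF Y] by blast
  then show "0 \<in> {y \<in> Y. \<phi> y = 0}"
    using subspace_0[OF Y] by simp
qed (use add scl subspace_add[OF Y] subspace_scale[OF Y] in auto)

text \<open>
  The kernel has codimension at most one: a finite spanning set of it, together with one vector
  on which \<open>\<phi>\<close> does not vanish, would span all of \<open>Y\<close>.
\<close>

lemma kernel_not_finitely_spanned:
  assumes Y: "subspace Y"
    and inf: "\<not> (\<exists>B. finite B \<and> Y = span B)"
    and add: "\<And>x y. x \<in> Y \<Longrightarrow> y \<in> Y \<Longrightarrow> \<phi> (x + y) = \<phi> x + \<phi> y"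
    and scl: "\<And>c x. x \<in> Y \<Longrightarrow> \<phi> (scale c x) = c * \<phi> x"
  shows "\<not> (\<exists>B. finite B \<and> {y \<in> Y. \<phi> y = 0} = span B)"
proof
  assume "\<exists>B. finite B \<and> {y \<in> Y. \<phi> y = 0} = span B"
  then obtain B where B: "finite B" and ker: "{y \<in> Y. \<phi> y = 0} = span B"
    by blast
  have BY: "span B \<subseteq> Y"
    using ker by auto
  obtain v where v: "v \<in> Y" "\<phi> v \<noteq> 0"
    using inf B ker by blast
  have "Y = span (insert v B)"
  proof
    show "span (insert v B) \<subseteq> Y"
      using v BY span_superset[of B] by (intro span_minimal Y) auto
    show "Y \<subseteq> span (insert v B)"
    proof
      fix y assume y: "y \<in> Y"
      let ?c = "\<phi> y / \<phi> v"
      have cv: "scale (- ?c) v \<in> Y"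
        using subspace_scale[OF Y] v by blast
      have "\<phi> (y + scale (- ?c) v) = 0"
        using add[OF y cv] scl[OF v(1), of "- ?c"] v(2) by simp
      moreover have "y + scale (- ?c) v \<in> Y"
        using subspace_add[OF Y y cv] .
      ultimately have "y + scale (- ?c) v \<in> span B"
        using ker by blast
      then have "y - scale ?c v \<in> span B"
        by simp
      then show "y \<in> span (insert v B)"
        using span_breakdown_eq by blast
    qed
  qed
  with inf B show False
    by blast
qed

text \<open>
  Imposing the conditions one at a time keeps the subspace from being finitely spanned, and the
  zero subspace is spanned by the empty set.
\<close>

lemma common_kernel_nontrivial:
  assumes X: "subspace X"
    and inf: "\<not> (\<exists>B. finite B \<and> X = span B)"
    and add: "\<And>i x y. i \<in> F \<Longrightarrow> x \<in> X \<Longrightarrow> y \<in> X \<Longrightarrow> \<phi> i (x + y) = \<phi> i x + \<phi> i y"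
    and scl: "\<And>i c x. i \<in> F \<Longrightarrow> x \<in> X \<Longrightarrow> \<phi> i (scale c x) = c * \<phi> i x"
    and fin: "finite F"
  obtains x where "x \<in> X" "x \<noteq> 0" "\<And>i. i \<in> F \<Longrightarrow> \<phi> i x = 0"
proof -
  define K where "K G = {x \<in> X. \<forall>i\<in>G. \<phi> i x = 0}" for G
  have "subspace (K F) \<and> \<not> (\<exists>B. finite B \<and> K F = span B)"
    using fin order_refl[of F]
  proof (induction rule: finite_subset_induct')
    case empty
    then show ?case
      using X inf by (simp add: K_def)
  next
    case (insert i G)
    have KG: "K (insert i G) = {x \<in> K G. \<phi> i x = 0}"
      by (auto simp: K_def)
    have sub: "subspace (K G)" and nf: "\<not> (\<exists>B. finite B \<and> K G = span B)"
      using insert.IH by auto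
    have a: "\<phi> i (x + y) = \<phi> i x + \<phi> i y" if "x \<in> K G" "y \<in> K G" for x y
      using that add[OF \<open>i \<in> F\<close>] by (simp add: K_def)
    have s: "\<phi> i (scale c x) = c * \<phi> i x" if "x \<in> K G" for c x
      using that scl[OF \<open>i \<in> F\<close>] by (simp add: K_def)
    show ?case
      using subspace_inter_kernel[of "K G" "\<phi> i", OF sub a s]
        kernel_not_finitely_spanned[of "K G" "\<phi> i", OF sub nf a s] KG by simp
  qed
  then have "K F \<noteq> span {}" "subspace (K F)"
    by blast+
  then obtain x where "x \<in> K F" "x \<noteq> 0"
    using subspace_0 by auto
  then show thesis
    using that by (auto simp: K_def)
qed

end

section \<open>Weak cluster points in reflexive spaces\<close>

text \<open>
  In a product of discs over a large index set a sequence need not have a convergent subsequence.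
  A cluster point still inherits every closed property that holds
  eventually along the sequence; this is the only way in which it is used.
\<close>

lemma compact_imp_cluster_point:
  fixes p :: "nat \<Rightarrow> 'a::topological_space"
  assumes "compact K" and "\<And>k. p k \<in> K"
  obtains x where "\<And>S. closed S \<Longrightarrow> (\<forall>\<^sub>F k in sequentially. p k \<in> S) \<Longrightarrow> x \<in> S"
proof -
  let ?F = "filtermap p sequentially"
  have "?F \<noteq> bot" "?F \<le> principal K"
    using assms(2) by (auto simp: filtermap_bot_iff le_principal eventually_filtermap)
  then obtain x where x: "inf (nhds x) ?F \<noteq> bot"
    using assms(1)[unfolded compact_filter, rule_format, of ?F] by (auto simp: le_principal)
  have "x \<in> S" if S: "closed S" and ev: "\<forall>\<^sub>F k in sequentially. p k \<in> S" for S
  proof (rule ccontr)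
    assume "x \<notin> S"
    then have "\<forall>\<^sub>F y in nhds x. y \<notin> S"
      using S eventually_nhds[of "\<lambda>y. y \<notin> S" x] by (auto intro!: exI[of _ "- S"])
    moreover have "\<forall>\<^sub>F y in ?F. y \<in> S"
      using ev by (simp add: eventually_filtermap)
    ultimately have "\<forall>\<^sub>F y in inf (nhds x) ?F. False"
      unfolding eventually_inf by blast
    with x show False
      by (simp add: eventually_False)
  qed
  then show thesis
    using that by blast
qed

locale complex_normed_space = vector_space scl
  for scl :: "complex \<Rightarrow> 'v::ab_group_add \<Rightarrow> 'v" +
  fixes nrm :: "'v \<Rightarrow> real"
  assumes nrm_scl: "nrm (scl c x) = cmod c * nrm x"
    and nrm_pos: "x \<noteq> 0 \<Longrightarrow> nrm x > 0"
    and nrm_triangle: "nrm (x + y) \<le> nrm x + nrm y"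
begin

lemma dual_space_add:
  assumes "\<phi> \<in> dual_space scl nrm X" "\<psi> \<in> dual_space scl nrm X"
  shows "\<phi> + \<psi> \<in> dual_space scl nrm X"
proof -
  obtain K where K: "\<And>x. x \<in> X \<Longrightarrow> cmod (\<phi> x) \<le> K * nrm x"
    using assms(1) unfolding dual_space_def by blast
  obtain L where L: "\<And>x. x \<in> X \<Longrightarrow> cmod (\<psi> x) \<le> L * nrm x"
    using assms(2) unfolding dual_space_def by blast
  have "cmod ((\<phi> + \<psi>) x) \<le> (K + L) * nrm x" if "x \<in> X" for x
    using norm_triangle_ineq[of "\<phi> x" "\<psi> x"] K[OF that] L[OF that]
    by (simp add: distrib_right)
  then have "\<exists>M. \<forall>x\<in>X. cmod ((\<phi> + \<psi>) x) \<le> M * nrm x"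
    by blast
  then show ?thesis
    using assms by (simp add: dual_space_def distrib_left add_ac)
qed

lemma dual_space_scale:
  assumes "\<phi> \<in> dual_space scl nrm X"
  shows "(\<lambda>x. c * \<phi> x) \<in> dual_space scl nrm X"
proof -
  obtain K where K: "\<And>x. x \<in> X \<Longrightarrow> cmod (\<phi> x) \<le> K * nrm x"
    using assms unfolding dual_space_def by blast
  have "cmod (c * \<phi> x) \<le> (cmod c * K) * nrm x" if "x \<in> X" for x
    using mult_left_mono[OF K[OF that], of "cmod c"] by (simp add: norm_mult mult.assoc)
  then have "\<exists>M. \<forall>x\<in>X. cmod (c * \<phi> x) \<le> M * nrm x"
    by blast
  then show ?thesis
    using assms by (simp add: dual_space_def distrib_left mult.left_commute)
qed

lemma cmod_le_dual_norm:
  assumes "\<phi> \<in> dual_space scl nrm X" "x \<in> X" "nrm x \<le> 1"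
  shows "cmod (\<phi> x) \<le> dual_norm nrm X \<phi>"
proof -
  obtain K where K: "\<And>x. x \<in> X \<Longrightarrow> cmod (\<phi> x) \<le> K * nrm x"
    using assms unfolding dual_space_def by blast
  have "cmod (\<phi> y) \<le> \<bar>K\<bar>" if "y \<in> X" "nrm y \<le> 1" for y
  proof -
    have "nrm y \<ge> 0"
      using nrm_pos[of y] nrm_scl[of 0 y] by (cases "y = 0") auto
    then have "K * nrm y \<le> \<bar>K\<bar> * 1"
      using that by (intro mult_mono) auto
    then show ?thesis
      using K[OF that(1)] by simp
  qed
  then have "bdd_above ((\<lambda>x. cmod (\<phi> x)) ` {x \<in> X. nrm x \<le> 1})"
    by (intro bdd_aboveI2[of _ _ "\<bar>K\<bar>"]) auto
  then show ?thesis
    unfolding dual_norm_def using assms by (intro cSUP_upper) auto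
qed

text \<open>
  Evaluations at vectors of the unit ball lie in a product of discs, which is compact by Tychonoff's
  theorem. Linearity and boundedness by the dual norm are closed conditions, so a cluster point
  of the evaluations is again in the bidual, and reflexivity makes it the evaluation at a vector.
\<close>

lemma reflexive_imp_weak_cluster_point:
  assumes refl: "reflexive_space scl nrm X"
    and f: "\<And>k. f k \<in> X" "\<And>k. nrm (f k) \<le> 1"
  shows "\<exists>x\<in>X. \<forall>\<phi>\<in>dual_space scl nrm X. \<forall>S. closed S \<longrightarrow>
    (\<forall>\<^sub>F k in sequentially. \<phi> (f k) \<in> S) \<longrightarrow> \<phi> x \<in> S"
proof -
  let ?D = "dual_space scl nrm X"
  define p where "p k = canonical_embedding scl nrm X (f k)" for k :: nat
  \<comment> \<open>Evaluations vanish off the dual space, where the disc degenerates to the single point \<open>0\<close>.\<close>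
  define r where "r \<phi> = (if \<phi> \<in> ?D then dual_norm nrm X \<phi> else 0)" for \<phi>
  define K where "K = PiE UNIV (\<lambda>\<phi>. cball (0::complex) (r \<phi>))"
  have "compactin (product_topology (\<lambda>_. euclidean) UNIV) K"
    unfolding K_def compactin_PiE by simp
  then have "compact K"
    by (simp add: euclidean_product_topology)
  moreover have "p k \<in> K" for k
    using f by (auto simp: K_def p_def r_def canonical_embedding_def cmod_le_dual_norm)
  ultimately obtain \<Phi> where \<Phi>:
    "\<And>S. closed S \<Longrightarrow> (\<forall>\<^sub>F k in sequentially. p k \<in> S) \<Longrightarrow> \<Phi> \<in> S"
    using compact_imp_cluster_point[of K p] by blast
  have cont: "continuous_on UNIV (\<lambda>q :: ('v \<Rightarrow> complex) \<Rightarrow> complex. q \<phi>)" for \<phi>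
    by simp
  have off: "\<Phi> \<phi> = 0" if "\<phi> \<notin> ?D" for \<phi>
    using \<Phi>[of "{q. q \<phi> = 0}"] that
    by (simp add: closed_Collect_eq[OF cont] p_def canonical_embedding_def)
  have add: "\<Phi> (\<phi> + \<psi>) = \<Phi> \<phi> + \<Phi> \<psi>" if "\<phi> \<in> ?D" "\<psi> \<in> ?D" for \<phi> \<psi>
  proof -
    have "closed {q :: ('v \<Rightarrow> complex) \<Rightarrow> complex. q (\<phi> + \<psi>) = q \<phi> + q \<psi>}"
      by (intro closed_Collect_eq continuous_on_add cont)
    then show ?thesis
      using \<Phi>[of "{q. q (\<phi> + \<psi>) = q \<phi> + q \<psi>}"] that dual_space_add[OF that]
      by (simp add: p_def canonical_embedding_def)
  qed
  have scale: "\<Phi> (\<lambda>x. c * \<phi> x) = c * \<Phi> \<phi>" if "\<phi> \<in> ?D" for c \<phi>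
  proof -
    have "closed {q :: ('v \<Rightarrow> complex) \<Rightarrow> complex. q (\<lambda>x. c * \<phi> x) = c * q \<phi>}"
      by (intro closed_Collect_eq continuous_on_mult continuous_on_const cont)
    then show ?thesis
      using \<Phi>[of "{q. q (\<lambda>x. c * \<phi> x) = c * q \<phi>}"] that dual_space_scale[OF that]
      by (simp add: p_def canonical_embedding_def)
  qed
  have bound: "cmod (\<Phi> \<phi>) \<le> 1 * dual_norm nrm X \<phi>" if "\<phi> \<in> ?D" for \<phi>
  proof -
    have "closed {q :: ('v \<Rightarrow> complex) \<Rightarrow> complex. cmod (q \<phi>) \<le> dual_norm nrm X \<phi>}"
      by (intro closed_Collect_le continuous_on_norm continuous_on_const cont)
    then show ?thesis
      using \<Phi>[of "{q. cmod (q \<phi>) \<le> dual_norm nrm X \<phi>}"] that f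
      by (simp add: p_def canonical_embedding_def cmod_le_dual_norm)
  qed
  have "\<Phi> \<in> bidual_space scl nrm X"
    unfolding bidual_space_def dual_space_def[of _ "dual_norm nrm X"]
    using off add scale bound by blast
  then obtain x where x: "x \<in> X" "\<Phi> = canonical_embedding scl nrm X x"
    using refl unfolding reflexive_space_def by blast
  have "\<phi> x \<in> S"
    if "\<phi> \<in> ?D" "closed S" "\<forall>\<^sub>F k in sequentially. \<phi> (f k) \<in> S" for \<phi> S
  proof -
    have "closed {q :: ('v \<Rightarrow> complex) \<Rightarrow> complex. q \<phi> \<in> S}"
      using closed_vimage[OF \<open>closed S\<close> cont[of \<phi>]] by (simp add: vimage_def)
    then show ?thesis
      using \<Phi>[of "{q. q \<phi> \<in> S}"] that x by (simp add: p_def canonical_embedding_def)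
  qed
  with x(1) show ?thesis
    by blast
qed

end

section \<open>Operators from a reflexive space to \<open>\<ell>\<^sup>1\<close>\<close>

lemma cnj_sgn_mult_self: "cnj (sgn z) * z = of_real (cmod z)"
proof (cases "z = 0")
  case False
  have "cnj (sgn z) * z = z * cnj z / of_real (cmod z)"
    by (simp add: sgn_eq)
  also have "\<dots> = of_real (cmod z)"
    using False by (simp add: complex_norm_square[symmetric] power2_eq_square)
  finally show ?thesis .
qed simp

context complex_normed_space
begin

text \<open>
  The operator is given by its coordinates \<open>\<phi> i\<close>, and \<open>M\<close> bounds its norm. The proof makes the
  non-reflexivity of \<open>\<ell>\<^sup>1\<close> explicit: it plays the coordinatewise limit of a gliding hump
  against a functional that takes large values on every hump.
\<close>

theorem reflexive_to_l1_not_bounded_below: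
  fixes \<phi> :: "'i \<Rightarrow> 'v \<Rightarrow> complex" and I :: "'i set"
  assumes X: "subspace X"
    and refl: "reflexive_space scl nrm X"
    and inf: "\<not> (\<exists>B. finite B \<and> X = span B)"
    and add: "\<And>i x y. i \<in> I \<Longrightarrow> x \<in> X \<Longrightarrow> y \<in> X \<Longrightarrow> \<phi> i (x + y) = \<phi> i x + \<phi> i y"
    and scale: "\<And>i c x. i \<in> I \<Longrightarrow> x \<in> X \<Longrightarrow> \<phi> i (scl c x) = c * \<phi> i x"
    and bound: "\<And>F x. finite F \<Longrightarrow> F \<subseteq> I \<Longrightarrow> x \<in> X \<Longrightarrow> (\<Sum>i\<in>F. cmod (\<phi> i x)) \<le> M * nrm x"
    and "C > 0"
  shows "\<exists>x\<in>X. (\<lambda>i. cmod (\<phi> i x)) summable_on I \<and> (\<Sum>\<^sub>\<infinity>i\<in>I. cmod (\<phi> i x)) < C * nrm x"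
proof (rule ccontr)
  have summable: "(\<lambda>i. cmod (\<phi> i x)) summable_on I" if "x \<in> X" for x
    using bound[OF _ _ that]
    by (intro nonneg_bdd_above_summable_on bdd_aboveI2[of _ _ "M * nrm x"]) auto
  assume "\<not> ?thesis"
  then have below: "(\<Sum>\<^sub>\<infinity>i\<in>I. cmod (\<phi> i x)) \<ge> C * nrm x" if "x \<in> X" for x
    using summable that by (meson not_le)
  define \<delta> where "\<delta> = C / 4"
  have "\<delta> > 0"
    using \<open>C > 0\<close> by (simp add: \<delta>_def)
  \<comment> \<open>For a finite set \<open>F\<close> of coordinates, \<open>g F\<close> is a unit vector that is invisible on \<open>F\<close>, and
    \<open>N F\<close> enlarges \<open>F\<close> so as to carry all but \<open>\<delta>\<close> of the absolute sum of the coordinates of \<open>g F\<close>.\<close>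
  have unit: "\<exists>x. x \<in> X \<and> nrm x = 1 \<and> (\<forall>i\<in>F. \<phi> i x = 0)" if F: "finite F" "F \<subseteq> I" for F
  proof -
    obtain x where x: "x \<in> X" "x \<noteq> 0" "\<And>i. i \<in> F \<Longrightarrow> \<phi> i x = 0"
    proof (rule common_kernel_nontrivial[OF X inf, of F \<phi>])
      show "\<phi> i (y + z) = \<phi> i y + \<phi> i z" if "i \<in> F" "y \<in> X" "z \<in> X" for i y z
        using that F add by auto
      show "\<phi> i (scl c y) = c * \<phi> i y" if "i \<in> F" "y \<in> X" for i c y
        using that F scale by auto
    qed (use F in auto)
    define y where "y = scl (of_real (inverse (nrm x))) x"
    have "nrm y = 1"
      using nrm_pos[OF x(2)] by (simp add: y_def nrm_scl norm_inverse)
    moreover have "y \<in> X" "\<forall>i\<in>F. \<phi> i y = 0"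
      using x F scale X by (auto simp: y_def subspace_scale)
    ultimately show ?thesis
      by blast
  qed
  then obtain g where g: "\<And>F. finite F \<Longrightarrow> F \<subseteq> I \<Longrightarrow> g F \<in> X"
    "\<And>F. finite F \<Longrightarrow> F \<subseteq> I \<Longrightarrow> nrm (g F) = 1"
    "\<And>F i. finite F \<Longrightarrow> F \<subseteq> I \<Longrightarrow> i \<in> F \<Longrightarrow> \<phi> i (g F) = 0"
    by metis
  have "\<exists>G. (finite G \<and> F \<subseteq> G \<and> G \<subseteq> I) \<and>
      (\<Sum>\<^sub>\<infinity>i\<in>I. cmod (\<phi> i (g F))) - \<delta> \<le> (\<Sum>i\<in>G. cmod (\<phi> i (g F)))"
    if F: "finite F" "F \<subseteq> I" for F
  proof -
    obtain G where G: "finite G" "G \<subseteq> I"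
      "dist (\<Sum>i\<in>G. cmod (\<phi> i (g F))) (\<Sum>\<^sub>\<infinity>i\<in>I. cmod (\<phi> i (g F))) \<le> \<delta>"
      using infsum_finite_approximation[OF summable[OF g(1)[OF F]] \<open>\<delta> > 0\<close>] by blast
    have "(\<Sum>i\<in>G. cmod (\<phi> i (g F))) \<le> (\<Sum>i\<in>F \<union> G. cmod (\<phi> i (g F)))"
      using F G by (intro sum_mono2) auto
    then show ?thesis
      using F G by (intro exI[of _ "F \<union> G"]) (auto simp: dist_real_def)
  qed
  then have "\<forall>F\<in>{F. finite F \<and> F \<subseteq> I}. \<exists>G. (finite G \<and> F \<subseteq> G \<and> G \<subseteq> I) \<and>
      (\<Sum>\<^sub>\<infinity>i\<in>I. cmod (\<phi> i (g F))) - \<delta> \<le> (\<Sum>i\<in>G. cmod (\<phi> i (g F)))"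
    by blast
  from bchoice[OF this] obtain N where "\<forall>F\<in>{F. finite F \<and> F \<subseteq> I}.
      (finite (N F) \<and> F \<subseteq> N F \<and> N F \<subseteq> I) \<and>
      (\<Sum>\<^sub>\<infinity>i\<in>I. cmod (\<phi> i (g F))) - \<delta> \<le> (\<Sum>i\<in>N F. cmod (\<phi> i (g F)))" ..
  then have N: "finite (N F)" "F \<subseteq> N F" "N F \<subseteq> I"
      "(\<Sum>\<^sub>\<infinity>i\<in>I. cmod (\<phi> i (g F))) - \<delta> \<le> (\<Sum>i\<in>N F. cmod (\<phi> i (g F)))"
    if "finite F" "F \<subseteq> I" for F
    using that by auto
  \<comment> \<open>Iterating \<open>N\<close> produces the humps: \<open>f k\<close> lives on \<open>F (Suc k) - F k\<close> up to \<open>\<delta>\<close>.\<close>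
  define F where "F k = (N ^^ k) {}" for k
  define f where "f k = g (F k)" for k
  have F: "finite (F k)" "F k \<subseteq> I" for k
    by (induction k) (auto simp: F_def N)
  have F_Suc: "F (Suc k) = N (F k)" for k
    by (simp add: F_def)
  have "mono F"
    by (intro mono_iff_le_Suc[THEN iffD2] allI) (simp add: F_Suc N F)
  have f: "f k \<in> X" "nrm (f k) = 1" "\<And>i. i \<in> F k \<Longrightarrow> \<phi> i (f k) = 0" for k
    using g F by (auto simp: f_def)
  have hump: "(\<Sum>\<^sub>\<infinity>i\<in>I. cmod (\<phi> i (f k))) - \<delta> \<le> (\<Sum>i\<in>F (Suc k). cmod (\<phi> i (f k)))" for k
    using N(4)[OF F] by (simp add: f_def F_Suc)
  \<comment> \<open>The least \<open>k\<close> with \<open>i \<in> F (Suc k)\<close> is the index of the one hump that owns the coordinate \<open>i\<close>.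
    Coordinates in no \<open>F k\<close> get weight zero, since nothing is known about them at the cluster
    point.\<close>
  define c where "c i = (if i \<in> (\<Union>k. F k) then cnj (sgn (\<phi> i (f (LEAST k. i \<in> F (Suc k))))) else 0)" for i
  have c_le: "cmod (c i) \<le> 1" for i
    by (simp add: c_def norm_sgn)
  have c_hump: "c i * \<phi> i (f k) = of_real (cmod (\<phi> i (f k)))" if "i \<in> F (Suc k)" for i k
  proof (cases "i \<in> F k")
    case True
    then show ?thesis
      using f by simp
  next
    case False
    have "(LEAST l. i \<in> F (Suc l)) = k"
    proof (rule Least_equality)
      show "k \<le> l" if "i \<in> F (Suc l)" for l
        using that False \<open>mono F\<close> monoD[of F "Suc l" k] by (meson not_less_eq_eq subsetD)
    qed fact
    then have "c i = cnj (sgn (\<phi> i (f k)))"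
      using that by (auto simp: c_def)
    then show ?thesis
      by (simp add: cnj_sgn_mult_self)
  qed
  \<comment> \<open>On \<open>F (Suc k)\<close> the weights turn the coordinates of \<open>f k\<close> into their moduli, so \<open>\<psi> (f k)\<close>
    differs from the norm of the image of \<open>f k\<close> by at most \<open>2 * \<delta> = C / 2\<close>.\<close>
  define \<psi> where "\<psi> x = (if x \<in> X then \<Sum>\<^sub>\<infinity>i\<in>I. c i * \<phi> i x else 0)" for x
  have c_term: "cmod (c i * \<phi> i x) \<le> cmod (\<phi> i x)" for i x
    using mult_right_mono[OF c_le[of i] norm_ge_zero[of "\<phi> i x"]] by (simp add: norm_mult)
  have abs_c: "(\<lambda>i. cmod (c i * \<phi> i x)) summable_on A" if "x \<in> X" "A \<subseteq> I" for x A
    by (rule Infinite_Sum.abs_summable_on_comparison_test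
        [OF summable_on_subset_banach[OF summable[OF that(1)] that(2)] c_term])
  have sum_c: "(\<lambda>i. c i * \<phi> i x) summable_on A" if "x \<in> X" "A \<subseteq> I" for x A
    by (rule Infinite_Sum.abs_summable_summable[OF abs_c[OF that]])
  have cmod_c: "cmod (\<Sum>\<^sub>\<infinity>i\<in>A. c i * \<phi> i x) \<le> (\<Sum>\<^sub>\<infinity>i\<in>A. cmod (\<phi> i x))" if "x \<in> X" "A \<subseteq> I" for x A
    using norm_infsum_bound[OF abs_c[OF that]]
      infsum_mono[OF abs_c[OF that] summable_on_subset_banach[OF summable[OF that(1)] that(2)] c_term]
    by linarith
  have "\<psi> \<in> dual_space scl nrm X"
  proof -
    have "\<psi> (x + y) = \<psi> x + \<psi> y" if "x \<in> X" "y \<in> X" for x y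
    proof -
      have "(\<Sum>\<^sub>\<infinity>i\<in>I. c i * \<phi> i (x + y)) = (\<Sum>\<^sub>\<infinity>i\<in>I. c i * \<phi> i x + c i * \<phi> i y)"
        using that by (intro infsum_cong) (simp add: add distrib_left)
      also have "\<dots> = (\<Sum>\<^sub>\<infinity>i\<in>I. c i * \<phi> i x) + (\<Sum>\<^sub>\<infinity>i\<in>I. c i * \<phi> i y)"
        using that by (intro infsum_add sum_c) auto
      finally show ?thesis
        using that subspace_add[OF X that] by (simp add: \<psi>_def)
    qed
    moreover have "\<psi> (scl a x) = a * \<psi> x" if "x \<in> X" for a x
    proof -
      have "(\<Sum>\<^sub>\<infinity>i\<in>I. c i * \<phi> i (scl a x)) = (\<Sum>\<^sub>\<infinity>i\<in>I. a * (c i * \<phi> i x))"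
        using that by (intro infsum_cong) (simp add: scale)
      also have "\<dots> = a * (\<Sum>\<^sub>\<infinity>i\<in>I. c i * \<phi> i x)"
        by (rule infsum_cmult_right')
      finally show ?thesis
        using that subspace_scale[OF X that] by (simp add: \<psi>_def)
    qed
    moreover have "cmod (\<psi> x) \<le> M * nrm x" if "x \<in> X" for x
      using cmod_c[OF that order_refl] infsum_le_finite_sums[OF summable[OF that] bound[OF _ _ that]] that
      by (simp add: \<psi>_def)
    moreover have "\<psi> x = 0" if "x \<notin> X" for x
      using that by (simp add: \<psi>_def)
    ultimately show ?thesis
      unfolding dual_space_def by blast
  qed
  have \<psi>_hump: "cmod (\<psi> (f k)) \<ge> C / 2" for k
  proof -
    let ?S = "\<Sum>\<^sub>\<infinity>i\<in>I. cmod (\<phi> i (f k))" and ?H = "\<Sum>i\<in>F (Suc k). cmod (\<phi> i (f k))"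
    let ?T = "I - F (Suc k)"
    have un: "I = F (Suc k) \<union> ?T"
      using F by blast
    have "?S = ?H + (\<Sum>\<^sub>\<infinity>i\<in>?T. cmod (\<phi> i (f k)))"
      using infsum_Un_disjoint[of "\<lambda>i. cmod (\<phi> i (f k))" "F (Suc k)" ?T] un F f
        summable_on_subset_banach[OF summable[OF f(1)[of k]]] by simp
    then have tail: "(\<Sum>\<^sub>\<infinity>i\<in>?T. cmod (\<phi> i (f k))) \<le> \<delta>"
      using hump[of k] by simp
    have "\<psi> (f k) = (\<Sum>i\<in>F (Suc k). c i * \<phi> i (f k)) + (\<Sum>\<^sub>\<infinity>i\<in>?T. c i * \<phi> i (f k))"
      using infsum_Un_disjoint[of "\<lambda>i. c i * \<phi> i (f k)" "F (Suc k)" ?T] un F f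
        sum_c[OF f(1)[of k]] by (simp add: \<psi>_def)
    also have "(\<Sum>i\<in>F (Suc k). c i * \<phi> i (f k)) = of_real ?H"
      using c_hump by simp
    finally have "cmod (of_real ?H) \<le> cmod (\<psi> (f k)) + cmod (\<Sum>\<^sub>\<infinity>i\<in>?T. c i * \<phi> i (f k))"
      using norm_triangle_ineq4[of "\<psi> (f k)" "\<Sum>\<^sub>\<infinity>i\<in>?T. c i * \<phi> i (f k)"] by simp
    moreover have "cmod (of_real ?H) = ?H"
      by (simp add: sum_nonneg del: of_real_sum)
    moreover have "C \<le> ?S"
      using below[OF f(1)[of k]] f(2)[of k] by simp
    ultimately show ?thesis
      using tail cmod_c[OF f(1)[of k], of ?T] hump[of k] by (simp add: \<delta>_def)
  qed
  obtain x where x: "x \<in> X" and weak: "\<forall>\<theta>\<in>dual_space scl nrm X. \<forall>S. closed S \<longrightarrow>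
      (\<forall>\<^sub>F k in sequentially. \<theta> (f k) \<in> S) \<longrightarrow> \<theta> x \<in> S"
    using reflexive_imp_weak_cluster_point[of X f, OF refl f(1) eq_refl[OF f(2)]] by (rule bexE)
  have cluster: "\<theta> x \<in> S" if "\<theta> \<in> dual_space scl nrm X" "closed S"
      "\<forall>\<^sub>F k in sequentially. \<theta> (f k) \<in> S" for \<theta> S
    using weak that by simp
  have coord_0: "\<phi> i x = 0" if i: "i \<in> F m" for i m
  proof -
    define \<theta> where "\<theta> y = (if y \<in> X then \<phi> i y else 0)" for y
    have "i \<in> I"
      using i F by blast
    then have \<theta>: "\<theta> \<in> dual_space scl nrm X"
      using X add scale bound[of "{i}"]
      by (auto simp: dual_space_def \<theta>_def subspace_add subspace_scale intro!: exI[of _ M])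
    have ev: "\<forall>\<^sub>F k in sequentially. \<theta> (f k) \<in> {0}"
      using eventually_ge_at_top[of m]
    proof eventually_elim
      case (elim k)
      then have "i \<in> F k"
        using i monoD[OF \<open>mono F\<close>] by blast
      then show ?case
        using f by (simp add: \<theta>_def)
    qed
    have "\<theta> x \<in> {0}"
      by (rule cluster[OF \<theta> closed_singleton ev])
    then show ?thesis
      using x by (simp add: \<theta>_def)
  qed
  have "c i * \<phi> i x = 0" for i
    using coord_0 by (auto simp: c_def)
  then have "(\<Sum>\<^sub>\<infinity>i\<in>I. c i * \<phi> i x) = 0"
    by (rule infsum_0)
  then have "\<psi> x = 0"
    by (simp add: \<psi>_def)
  moreover have "\<psi> x \<in> {z. C / 2 \<le> cmod z}"
    using \<psi>_hump by (intro cluster \<open>\<psi> \<in> _\<close> closed_Collect_le continuous_intros) auto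
  ultimately show False
    using \<open>C > 0\<close> by simp
qed

end

section \<open>Averages over the cubes\<close>

lemma norm_scale_L1: "norm (scale_L1 c f) = cmod c * norm f"
  by transfer (simp add: norm_mult)

interpretation L1_normed: complex_normed_space "scale_L1 :: complex \<Rightarrow> 'a::euclidean_space L1 \<Rightarrow> 'a L1" norm
  by unfold_locales (auto simp: norm_scale_L1 norm_triangle_ineq)

lemma integral_L1_add:
  assumes "S \<in> sets lebesgue"
  shows "integral_L1 S (f + g) = integral_L1 S f + integral_L1 S g"
  using assms
proof (transfer fixing: S)
  fix f g :: "'a \<Rightarrow> complex"
  assume S: "S \<in> sets lebesgue" and "L1_rel f f" "L1_rel g g"
  then have "set_integrable lebesgue S f" "set_integrable lebesgue S g"
    unfolding set_integrable_def by (auto simp: L1_rel_def intro!: integrable_mult_indicator)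
  then show "(LINT x:S|lebesgue. f x + g x) = (LINT x:S|lebesgue. f x) + (LINT x:S|lebesgue. g x)"
    by (rule set_integral_add)
qed

lemma integral_L1_scale: "integral_L1 S (scale_L1 c f) = c * integral_L1 S f"
  by transfer (rule set_integral_mult_right)

lemma dilate_cube_measurable:
  assumes "\<beta> > 0" "Q \<in> integer_cubes"
  shows "dilate \<beta> Q \<in> sets lebesgue"
proof -
  obtain c where "Q = unit_cube c"
    using assms(2) unfolding integer_cubes_def by blast
  then have "closed (dilate \<beta> Q)"
    unfolding dilate_unit_cube[OF assms(1), of c, folded \<open>Q = unit_cube c\<close>]
    by (intro closed_Collect_all closed_Collect_conj closed_Collect_le continuous_intros)
  then show ?thesis
    by (intro sets_completionI_sets) simp
qed

text \<open>
  Off the countably many hyperplanes \<open>x\<^sub>k = \<beta> m\<close>, the cube that contains \<open>x\<close> can be read off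
  from the integer parts of \<open>x\<^sub>k / \<beta>\<close>.
\<close>

lemma dilated_cubes_overlap_AE:
  fixes \<beta> :: real
  assumes "\<beta> > 0"
  shows "AE x :: real ^ 'n in lebesgue. \<forall>c d.
    x \<in> dilate \<beta> (unit_cube c) \<longrightarrow> x \<in> dilate \<beta> (unit_cube d) \<longrightarrow> c = d"
proof -
  let ?N = "\<Union>k. \<Union>m::int. {x :: real ^ 'n. x $ k = \<beta> * of_int m}"
  have "negligible ?N"
    by (auto intro!: negligible_countable_Union negligible_standard_hyperplane
        simp: cart_eq_inner_axis)
  then have "AE x in lebesgue. x \<notin> ?N"
    unfolding negligible_iff_null_sets by (rule AE_not_in)
  then show ?thesis
  proof eventually_elim
    case (elim x)
    show ?case
    proof (intro allI impI)
      fix c d :: "int ^ 'n"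
      assume cd: "x \<in> dilate \<beta> (unit_cube c)" "x \<in> dilate \<beta> (unit_cube d)"
      have fl: "e $ k = \<lfloor>x $ k / \<beta>\<rfloor>" if "x \<in> dilate \<beta> (unit_cube e)" for e k
      proof -
        have "\<beta> * of_int (e $ k) \<le> x $ k" "x $ k \<le> \<beta> * (of_int (e $ k) + 1)"
          using that by (auto simp: dilate_unit_cube[OF assms])
        moreover have "x $ k \<noteq> \<beta> * of_int (e $ k + 1)"
          using elim by blast
        ultimately show ?thesis
          using assms by (intro floor_unique[symmetric]) (auto simp: field_simps)
      qed
      show "c = d"
        using fl[OF cd(1)] fl[OF cd(2)] by (simp add: vec_eq_iff)
    qed
  qed
qed

lemma sum_cube_integrals_le_norm:
  fixes f :: "(real ^ 'n) L1"
  assumes "\<beta> > 0" "finite F" "F \<subseteq> integer_cubes"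
  shows "(\<Sum>Q\<in>F. cmod (integral_L1 (dilate \<beta> Q) f)) \<le> norm f"
proof (transfer fixing: \<beta> F)
  fix f :: "real ^ 'n \<Rightarrow> complex"
  assume "L1_rel f f"
  then have f: "integrable lebesgue f"
    by (simp add: L1_rel_def)
  have meas: "dilate \<beta> Q \<in> sets lebesgue" if "Q \<in> F" for Q
    using that assms by (intro dilate_cube_measurable) auto
  have int: "integrable lebesgue (\<lambda>x. indicator (dilate \<beta> Q) x * cmod (f x))" if "Q \<in> F" for Q
    using integrable_mult_indicator[OF meas[OF that] integrable_norm[OF f]] by simp
  have "(\<Sum>Q\<in>F. cmod (set_lebesgue_integral lebesgue (dilate \<beta> Q) f))
      \<le> (\<Sum>Q\<in>F. \<integral>x. indicator (dilate \<beta> Q) x * cmod (f x) \<partial>lebesgue)"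
    unfolding set_lebesgue_integral_def
    by (intro sum_mono order_trans[OF integral_norm_bound]) simp
  also have "\<dots> = (\<integral>x. (\<Sum>Q\<in>F. indicator (dilate \<beta> Q) x * cmod (f x)) \<partial>lebesgue)"
    by (rule Bochner_Integration.integral_sum[symmetric]) (rule int)
  also have "\<dots> \<le> (\<integral>x. cmod (f x) \<partial>lebesgue)"
  proof (rule integral_mono_AE)
    show "AE x in lebesgue. (\<Sum>Q\<in>F. indicator (dilate \<beta> Q) x * cmod (f x)) \<le> cmod (f x)"
      using dilated_cubes_overlap_AE[OF assms(1)]
    proof eventually_elim
      case (elim x)
      have "P = Q" if "P \<in> F" "Q \<in> F" "x \<in> dilate \<beta> P" "x \<in> dilate \<beta> Q" for P Q
      proof -
        obtain c d where "P = unit_cube c" "Q = unit_cube d"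
          using \<open>P \<in> F\<close> \<open>Q \<in> F\<close> assms(3) unfolding integer_cubes_def by blast
        then show ?thesis
          using elim[rule_format, of c d] that by simp
      qed
      then have "card {Q \<in> F. x \<in> dilate \<beta> Q} \<le> 1"
        using assms(2) by (subst card_le_Suc0_iff_eq[unfolded One_nat_def[symmetric]]) auto
      moreover have "(\<Sum>Q\<in>F. indicator (dilate \<beta> Q) x :: real) = card {Q \<in> F. x \<in> dilate \<beta> Q}"
        using assms(2) by (simp add: indicator_def of_bool_def sum.If_cases Int_def)
      ultimately have "(\<Sum>Q\<in>F. indicator (dilate \<beta> Q) x :: real) \<le> 1"
        by simp
      from mult_right_mono[OF this norm_ge_zero[of "f x"]] show ?case
        by (simp add: sum_distrib_right)
    qed
  qed (use int f in auto)
  finally show "(\<Sum>Q\<in>F. cmod (set_lebesgue_integral lebesgue (dilate \<beta> Q) f))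
      \<le> (\<integral>x. cmod (f x) \<partial>lebesgue)" .
qed

theorem lemma6p5:
  fixes X :: "(real ^ 'n::finite) L1 set" and \<beta> C :: real
  assumes "L1.subspace X"
    and "reflexive_space scale_L1 norm X"
    and "\<not> (\<exists>B. finite B \<and> X = L1.span B)"
    and "\<beta> > 0" and "C > 0"
  shows "\<exists>f\<in>X. (\<lambda>Q. cmod (integral_L1 (dilate \<beta> Q) f)) summable_on integer_cubes \<and>
    (\<Sum>\<^sub>\<infinity>Q\<in>integer_cubes. cmod (integral_L1 (dilate \<beta> Q) f)) < C * norm f"
proof (rule L1_normed.reflexive_to_l1_not_bounded_below[OF assms(1-3), where M = 1])
  show "integral_L1 (dilate \<beta> Q) (f + g) = integral_L1 (dilate \<beta> Q) f + integral_L1 (dilate \<beta> Q) g"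
    if "Q \<in> integer_cubes" for Q and f g :: "(real ^ 'n) L1"
    using dilate_cube_measurable[OF \<open>\<beta> > 0\<close> that] by (rule integral_L1_add)
qed (use assms in \<open>auto simp: integral_L1_scale sum_cube_integrals_le_norm\<close>)

end
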